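(* Let $m$ and $s$ be positive integers with $s<m$, and let $S=\{\mathbf u\in\mathbb R^m:\|\mathbf u_+\|_0\le s\}$. For $\mathbf z\in S$ put $\Gamma_+=\{i:z_i>0\}$, $\Gamma_0=\{i:z_i=0\}$ and $\mathcal P=\{\Gamma\subseteq\Gamma_0:\ |\Gamma|\le s-|\Gamma_+|\}$. Then the Bouligand tangent cone of $S$ at $\mathbf z$ is $$T_S(\mathbf z)=\bigcup_{\Gamma\in\mathcal P}\Big\{\mathbf d\in\mathbb R^m:\ \mathbf d_{\Gamma_0\setminus\Gamma}\le 0\Big\}.$$
   Context: For $\mathbf u\in\mathbb R^m$, $\mathbf u_+$ is the entrywise positive part $\max\{u_i,0\}$ and $\|\cdot\|_0$ counts nonzero entries. For an index set $J$, $\mathbf d_J$ is the subvector of $\mathbf d$ indexed by $J$, and $\mathbf d_J\le 0$ is entrywise (vacuous if $J=\emptyset$). The Bouligand tangent cone of a nonempty set $\Omega\subseteq\mathbb R^m$ at $\mathbf z\in\Omega$ is $T_\Omega(\mathbf z)=\{\mathbf d\in\mathbb R^m:\ \exists\,\eta_k\ge 0,\ \{\mathbf z^k\}\subseteq\Omega,\ \lim_{k\to\infty}\mathbf z^k=\mathbf z,\ \text{such that } \lim_{k\to\infty}\eta_k(\mathbf z^k-\mathbf z)=\mathbf d\}$. *)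

theory Defs
  imports "HOL-Analysis.Analysis"
begin

definition pos_part :: "real ^ 'm \<Rightarrow> real ^ 'm" where
  "pos_part u = (\<chi> i. max (u $ i) 0)"

definition norm0 :: "real ^ 'm \<Rightarrow> nat" where
  "norm0 u = card {i. u $ i \<noteq> 0}"

(* Intended for z in Omega; the scalars eta need not be positive or tend to infinity. *)
definition bouligand_tangent_cone :: "'a::real_normed_vector set \<Rightarrow> 'a \<Rightarrow> 'a set" where
  "bouligand_tangent_cone \<Omega> z =
    {d. \<exists>(\<eta> :: nat \<Rightarrow> real) (x :: nat \<Rightarrow> 'a).
          (\<forall>k. \<eta> k \<ge> 0) \<and> (\<forall>k. x k \<in> \<Omega>) \<and> x \<longlonglongrightarrow> z \<and>
          (\<lambda>k. \<eta> k *\<^sub>R (x k - z)) \<longlonglongrightarrow> d}"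

definition S_set :: "nat \<Rightarrow> (real ^ 'm) set" where
  "S_set s = {u. norm0 (pos_part u) \<le> s}"

definition Gamma_plus :: "real ^ 'm \<Rightarrow> 'm set" where
  "Gamma_plus z = {i. z $ i > 0}"

definition Gamma_zero :: "real ^ 'm \<Rightarrow> 'm set" where
  "Gamma_zero z = {i. z $ i = 0}"

(* The difference is taken in the integers to avoid truncated subtraction. *)
definition P_set :: "nat \<Rightarrow> real ^ 'm \<Rightarrow> 'm set set" where
  "P_set s z = {\<Gamma>. \<Gamma> \<subseteq> Gamma_zero z \<and> int (card \<Gamma>) \<le> int s - int (card (Gamma_plus z))}"

end

theory Submission
  imports Defs
begin

text \<open>
  Membership of \<open>u\<close> in the constraint set only depends on the positive support
  \<open>{i. u $ i > 0}\<close>, which must have at most \<open>s\<close> elements. Strict inequalities persist under small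
  perturbations, so near \<open>z\<close> the support contains \<open>Gamma_plus z\<close> and avoids the indices with
  \<open>z $ i < 0\<close>; only the indices in \<open>Gamma_zero z\<close> can change status.

  If \<open>d\<close> is tangent, the indices of \<open>Gamma_zero z\<close> with \<open>d $ i > 0\<close> are positive in the
  approximating points as well, since the scalars \<open>\<eta> k\<close> are nonnegative. Together with
  \<open>Gamma_plus z\<close> they lie in a support of size at most \<open>s\<close>, so they form an admissible \<open>\<Gamma>\<close>.
  Conversely, if \<open>d\<close> is nonpositive on \<open>Gamma_zero z - \<Gamma>\<close>, a short step from \<open>z\<close> along \<open>d\<close> has
  positive support inside \<open>Gamma_plus z \<union> \<Gamma>\<close>. It therefore stays in the set, and a direction of
  feasible short steps is tangent.
\<close>

lemma S_set_iff: "u \<in> S_set s \<longleftrightarrow> card (Gamma_plus u) \<le> s"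
proof -
  have "{i. pos_part u $ i \<noteq> 0} = Gamma_plus u"
    by (auto simp: pos_part_def Gamma_plus_def max_def)
  then show ?thesis
    by (simp add: S_set_def norm0_def)
qed

lemma P_set_iff:
  "\<Gamma> \<in> P_set s z \<longleftrightarrow> \<Gamma> \<subseteq> Gamma_zero z \<and> card (Gamma_plus z \<union> \<Gamma>) \<le> s"
proof (cases "\<Gamma> \<subseteq> Gamma_zero z")
  case True
  then have "Gamma_plus z \<inter> \<Gamma> = {}"
    by (auto simp: Gamma_plus_def Gamma_zero_def)
  then have "card (Gamma_plus z \<union> \<Gamma>) = card (Gamma_plus z) + card \<Gamma>"
    by (simp add: card_Un_disjoint)
  with True show ?thesis
    by (auto simp: P_set_def)
qed (simp add: P_set_def)

text \<open>Feasible directions are tangent: the points \<open>z + t *\<^sub>R d\<close> tend to \<open>z\<close> as \<open>t\<close>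
  decreases to \<open>0\<close>, and their differences from \<open>z\<close>, rescaled by \<open>1 / t\<close>, equal \<open>d\<close>.\<close>

lemma feasible_direction_tangent:
  assumes "\<forall>\<^sub>F t in at_right 0. z + t *\<^sub>R d \<in> \<Omega>"
  shows "d \<in> bouligand_tangent_cone \<Omega> z"
proof -
  obtain e :: real where e: "e > 0" "\<And>t. 0 < t \<Longrightarrow> t < e \<Longrightarrow> z + t *\<^sub>R d \<in> \<Omega>"
    using assms by (auto simp: eventually_at_right_field)
  \<comment> \<open>The shift by two keeps every step, including the first, strictly below \<open>e\<close>.\<close>
  define t where "t k = e / real (k + 2)" for k
  have t: "0 < t k" "t k < e" for k
    using e(1) by (auto simp: t_def field_simps add_pos_nonneg)
  have "t \<longlonglongrightarrow> 0"
    unfolding t_def by (intro LIMSEQ_ignore_initial_segment lim_const_over_n)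
  then have "(\<lambda>k. z + t k *\<^sub>R d) \<longlonglongrightarrow> z + 0 *\<^sub>R d"
    by (intro tendsto_intros)
  moreover have "(1 / t k) *\<^sub>R (z + t k *\<^sub>R d - z) = d" for k
    using t(1)[of k] by simp
  ultimately show ?thesis
    unfolding bouligand_tangent_cone_def using t e(2)
    by (intro CollectI exI[of _ "\<lambda>k. 1 / t k"] exI[of _ "\<lambda>k. z + t k *\<^sub>R d"])
       (auto intro: less_imp_le)
qed

text \<open>Strict positivity survives the two limits that define a tangent vector: at indices of
  \<open>Gamma_plus z\<close> through the convergence to \<open>z\<close>, at indices of \<open>Gamma_zero z\<close> through the
  convergence of the rescaled differences: there the difference is the entry of the point itself,
  and a nonnegative scalar cannot make a nonpositive entry positive.\<close>

lemma tangent_positive_indices: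
  fixes z d :: "real ^ 'm"
  assumes "d \<in> bouligand_tangent_cone \<Omega> z"
  obtains u where "u \<in> \<Omega>" "Gamma_plus z \<union> (Gamma_zero z \<inter> Gamma_plus d) \<subseteq> Gamma_plus u"
proof -
  obtain \<eta> :: "nat \<Rightarrow> real" and x where \<eta>: "\<And>k. \<eta> k \<ge> 0" and x: "\<And>k. x k \<in> \<Omega>"
    and lim_x: "x \<longlonglongrightarrow> z" and lim_d: "(\<lambda>k. \<eta> k *\<^sub>R (x k - z)) \<longlonglongrightarrow> d"
    using assms by (auto simp: bouligand_tangent_cone_def)
  have "\<forall>\<^sub>F k in sequentially. x k $ i > 0"
    if "i \<in> Gamma_plus z \<union> (Gamma_zero z \<inter> Gamma_plus d)" for i
    using that
  proof
    assume "i \<in> Gamma_plus z"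
    then show ?thesis
      using order_tendstoD(1)[OF tendsto_vec_nth[OF lim_x]] by (simp add: Gamma_plus_def)
  next
    assume i: "i \<in> Gamma_zero z \<inter> Gamma_plus d"
    then have "\<forall>\<^sub>F k in sequentially. (\<eta> k *\<^sub>R (x k - z)) $ i > 0"
      using order_tendstoD(1)[OF tendsto_vec_nth[OF lim_d]] by (simp add: Gamma_plus_def)
    then show ?thesis
    proof eventually_elim
      case (elim k)
      then show ?case
        using i \<eta>[of k] by (simp add: Gamma_zero_def zero_less_mult_iff)
    qed
  qed
  then have "\<forall>\<^sub>F k in sequentially.
      \<forall>i \<in> Gamma_plus z \<union> (Gamma_zero z \<inter> Gamma_plus d). x k $ i > 0"
    by (intro eventually_ball_finite) auto
  then obtain k where "\<forall>i \<in> Gamma_plus z \<union> (Gamma_zero z \<inter> Gamma_plus d). x k $ i > 0"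
    using eventually_happens'[OF sequentially_bot] by blast
  then show thesis
    by (intro that[OF x[of k]]) (auto simp: Gamma_plus_def)
qed

text \<open>Along a short step, an index enters the positive support only if \<open>z\<close> vanishes there and
  \<open>d\<close> is positive: from a negative entry it takes a step of some minimal length to reach zero,
  and finitely many indices have a common positive bound.\<close>

lemma eventually_Gamma_plus_step:
  fixes z d :: "real ^ 'm"
  shows "\<forall>\<^sub>F t in at_right 0.
    Gamma_plus (z + t *\<^sub>R d) \<subseteq> Gamma_plus z \<union> (Gamma_zero z \<inter> Gamma_plus d)"
proof -
  have "\<forall>\<^sub>F t in at_right 0. z $ i < 0 \<longrightarrow> z $ i + t * d $ i < 0" for i
  proof (cases "z $ i < 0")
    case True
    have "((\<lambda>t. z $ i + t * d $ i) \<longlongrightarrow> z $ i + 0 * d $ i) (at_right 0)"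
      by (intro tendsto_intros)
    then show ?thesis
      by (rule order_tendstoD(2)[THEN eventually_mono]) (use True in simp_all)
  qed simp
  then have "\<forall>\<^sub>F t in at_right 0. \<forall>i. z $ i < 0 \<longrightarrow> z $ i + t * d $ i < 0"
    by (intro eventually_all_finite)
  moreover have "\<forall>\<^sub>F t::real in at_right 0. t > 0"
    by (rule eventually_at_right_less)
  ultimately show ?thesis
  proof eventually_elim
    case (elim t)
    show ?case
    proof
      fix i assume "i \<in> Gamma_plus (z + t *\<^sub>R d)"
      then have pos: "z $ i + t * d $ i > 0"
        by (simp add: Gamma_plus_def)
      then have "\<not> z $ i < 0"
        using elim(1) less_asym by blast
      then show "i \<in> Gamma_plus z \<union> (Gamma_zero z \<inter> Gamma_plus d)"
        using pos elim(2) by (auto simp: Gamma_plus_def Gamma_zero_def zero_less_mult_iff)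
    qed
  qed
qed

theorem proposition2p3:
  fixes s :: nat and z :: "real ^ 'm"
  assumes "0 < s" and "s < CARD('m)"
    and "z \<in> S_set s"
  shows "bouligand_tangent_cone (S_set s) z =
    (\<Union>\<Gamma> \<in> P_set s z. {d :: real ^ 'm. \<forall>i \<in> Gamma_zero z - \<Gamma>. d $ i \<le> 0})"
proof (intro equalityI subsetI)
  fix d :: "real ^ 'm"
  assume "d \<in> bouligand_tangent_cone (S_set s) z"
  then obtain u where "u \<in> S_set s"
    and "Gamma_plus z \<union> (Gamma_zero z \<inter> Gamma_plus d) \<subseteq> Gamma_plus u"
    by (rule tangent_positive_indices)
  then have "card (Gamma_plus z \<union> (Gamma_zero z \<inter> Gamma_plus d)) \<le> s"
    unfolding S_set_iff by (meson card_mono finite order_trans)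
  then have "Gamma_zero z \<inter> Gamma_plus d \<in> P_set s z"
    by (simp add: P_set_iff)
  moreover have "\<forall>i \<in> Gamma_zero z - (Gamma_zero z \<inter> Gamma_plus d). d $ i \<le> 0"
    by (auto simp: Gamma_plus_def)
  ultimately show "d \<in> (\<Union>\<Gamma> \<in> P_set s z. {d. \<forall>i \<in> Gamma_zero z - \<Gamma>. d $ i \<le> 0})"
    by blast
next
  fix d :: "real ^ 'm"
  assume "d \<in> (\<Union>\<Gamma> \<in> P_set s z. {d. \<forall>i \<in> Gamma_zero z - \<Gamma>. d $ i \<le> 0})"
  then obtain \<Gamma> where \<Gamma>: "card (Gamma_plus z \<union> \<Gamma>) \<le> s"
    and d: "\<forall>i \<in> Gamma_zero z - \<Gamma>. d $ i \<le> 0"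
    by (auto simp: P_set_iff)
  have sub: "Gamma_zero z \<inter> Gamma_plus d \<subseteq> \<Gamma>"
    using d by (force simp: Gamma_plus_def)
  have "\<forall>\<^sub>F t in at_right 0. z + t *\<^sub>R d \<in> S_set s"
    using eventually_Gamma_plus_step[of z d]
  proof eventually_elim
    case (elim t)
    then have "card (Gamma_plus (z + t *\<^sub>R d)) \<le> card (Gamma_plus z \<union> \<Gamma>)"
      using sub by (intro card_mono) auto
    with \<Gamma> show ?case
      by (simp add: S_set_iff)
  qed
  then show "d \<in> bouligand_tangent_cone (S_set s) z"
    by (rule feasible_direction_tangent)
qed

end
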